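(* For all integers $0\le k\le t$, $$f_k^t=(-1)^kz^k\frac{N_1^{t-k}}{D_t},\qquad g_k^t=(-1)^kz^k\frac{N_2^{t-k}}{D_t},\qquad h_k^t=(-1)^kz^k\frac{N_3^{t-k}}{D_t}.$$
   Context: A partial Łukasiewicz path read from right to left, of length $n\ge0$, is a lattice path starting at $(0,0)$, consisting of $n$ steps from $\{(1,j): j\in\mathbb{Z},\ j\le 1\}$, and never going below the $x$-axis. Its height is the maximal $y$-coordinate of its points. The step $(1,1)$ is an up-step, $(1,0)$ is a horizontal step, and $(1,-j)$ with $j\ge 1$ is a down-step. For $0\le k\le t$, $f_k^t$ (resp. $g_k^t$, $h_k^t$) is the generating function in $z$ in which the coefficient of $z^n$ is the number of such paths of length $n$ and of height at most $t$, ending at height ($y$-coordinate) $k$, whose last step is an up-step (resp. a down-step, a horizontal step); the empty path is counted in $f_0^t$, so $f_0^t=1$. The polynomials $D_t,N_1^t,N_2^t,N_3^t\in\mathbb{Z}[z]$ ($t\ge0$; superscripts on $N$ are indices, not powers) are defined as follows: $N_1^t=D_t$, and $D_t$, $N_2^t$, $N_3^t$ each satisfy the recurrence $X_{t+2}+X_{t+1}+zX_t=0$ for $t\ge0$, with initial values $D_0=z-1,\ D_1=1-2z$; $\ N_2^0=0,\ N_2^1=z^2$; $\ N_3^0=-z,\ N_3^1=z(1-z)$. *)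

theory Defs
  imports "HOL-Computational_Algebra.Computational_Algebra"
begin

text \<open>A lattice path from the origin with steps (1, j) is represented by the list of its vertical
  increments j; its points are (i, ycoord s i) for i \<le> length s.\<close>

definition ycoord :: "int list \<Rightarrow> nat \<Rightarrow> int" where
  "ycoord s i = sum_list (take i s)"

definition partial_luk_path :: "int list \<Rightarrow> bool" where
  "partial_luk_path s \<longleftrightarrow> (\<forall>j\<in>set s. j \<le> 1) \<and> (\<forall>i\<le>length s. 0 \<le> ycoord s i)"

definition path_height :: "int list \<Rightarrow> int" where
  "path_height s = Max (ycoord s ` {..length s})"

definition luk_paths :: "nat \<Rightarrow> nat \<Rightarrow> nat \<Rightarrow> int list set" where
  "luk_paths t k n = {s. partial_luk_path s \<and> length s = n \<and>
     path_height s \<le> int t \<and> ycoord s (length s) = int k}"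

text \<open>The set of steps is infinite, but the height bound makes every count below finite.\<close>

lemma finite_luk_paths: "finite (luk_paths t k n)"
proof -
  have "luk_paths t k n \<subseteq> {s. set s \<subseteq> {- int t..1} \<and> length s = n}"
  proof
    fix s assume "s \<in> luk_paths t k n"
    then have s: "\<And>j. j \<in> set s \<Longrightarrow> j \<le> 1" "\<And>i. i \<le> length s \<Longrightarrow> 0 \<le> ycoord s i"
        "length s = n" "path_height s \<le> int t"
      by (auto simp: luk_paths_def partial_luk_path_def)
    have le: "ycoord s i \<le> int t" if "i \<le> length s" for i
    proof -
      have "ycoord s i \<le> path_height s"
        unfolding path_height_def using that by (intro Max_ge) auto
      with s(4) show ?thesis by simp
    qed
    have "- int t \<le> s ! i" if "i < length s" for i
      using that le[of i] s(2)[of "Suc i"]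
      by (simp add: ycoord_def take_Suc_conv_app_nth)
    then show "s \<in> {s. set s \<subseteq> {- int t..1} \<and> length s = n}"
      using s(1,3) by (auto simp: in_set_conv_nth)
  qed
  then show ?thesis
    using finite_lists_length_eq[of "{- int t..1}" n] finite_subset by blast
qed

definition f_gf :: "nat \<Rightarrow> nat \<Rightarrow> rat fps" where
  "f_gf t k = Abs_fps (\<lambda>n. of_nat (card {s \<in> luk_paths t k n. s = [] \<or> last s = 1}))"

definition g_gf :: "nat \<Rightarrow> nat \<Rightarrow> rat fps" where
  "g_gf t k = Abs_fps (\<lambda>n. of_nat (card {s \<in> luk_paths t k n. s \<noteq> [] \<and> last s \<le> -1}))"

definition h_gf :: "nat \<Rightarrow> nat \<Rightarrow> rat fps" where
  "h_gf t k = Abs_fps (\<lambda>n. of_nat (card {s \<in> luk_paths t k n. s \<noteq> [] \<and> last s = 0}))"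

abbreviation Z :: "int poly" where
  "Z \<equiv> [:0, 1:]"

fun D :: "nat \<Rightarrow> int poly" where
  "D 0 = Z - 1"
| "D (Suc 0) = 1 - 2 * Z"
| "D (Suc (Suc t)) = - D (Suc t) - Z * D t"

definition N1 :: "nat \<Rightarrow> int poly" where
  "N1 t = D t"

fun N2 :: "nat \<Rightarrow> int poly" where
  "N2 0 = 0"
| "N2 (Suc 0) = Z ^ 2"
| "N2 (Suc (Suc t)) = - N2 (Suc t) - Z * N2 t"

fun N3 :: "nat \<Rightarrow> int poly" where
  "N3 0 = - Z"
| "N3 (Suc 0) = Z * (1 - Z)"
| "N3 (Suc (Suc t)) = - N3 (Suc t) - Z * N3 t"

definition rat_fps :: "int poly \<Rightarrow> rat fps" where
  "rat_fps p = fps_of_poly (map_poly of_int p)"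

text \<open>The denominators are units, so the quotients in the power series ring are genuine.\<close>

lemma rat_fps_D_nth_0: "fps_nth (rat_fps (D t)) 0 = (-1) ^ Suc t"
proof -
  have "coeff (D t) 0 = (-1) ^ Suc t"
    by (induction t rule: D.induct) (simp_all add: numeral_poly)
  then show ?thesis by (simp add: rat_fps_def coeff_map_poly)
qed

end

theory Submission
  imports Defs
begin

text \<open>
  Removing the last step of a path leaves an arbitrary path that is shorter by one step and ends
  at height at most \<open>t\<close>, from which the removed step leads to height \<open>k\<close>. Sorting by the kind of
  the removed step turns this into a linear system: with \<open>w\<^sub>j = f\<^sub>j + g\<^sub>j + h\<^sub>j\<close>,
  one has \<open>f\<^sub>0 = 1\<close>, \<open>f\<^sub>k = z w\<^bsub>k-1\<^esub>\<close> for \<open>k > 0\<close>, \<open>g\<^sub>k = z (w\<^bsub>k+1\<^esub> + \<dots> + w\<^sub>t)\<close> and \<open>h\<^sub>k = z w\<^sub>k\<close>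
  (\<open>luk_system_gf\<close>; the bijection behind it is \<open>snoc_in_luk_paths_iff\<close>).

  Every occurrence of an unknown on a right-hand side carries a factor \<open>z\<close>, so the coefficients
  of \<open>z\<^sup>n\<close> determine those of \<open>z\<^sup>n\<^sup>+\<^sup>1\<close> and the system has at most one solution
  (\<open>luk_system_unique\<close>).

  It remains to see that the claimed quotients solve it. The sum in the
  equation for \<open>g\<close> telescopes to \<open>g\<^sub>k = g\<^bsub>k+1\<^esub> + z w\<^bsub>k+1\<^esub>\<close> with \<open>g\<^sub>t = 0\<close>; after
  cancelling powers of \<open>-z\<close> and the common denominator \<open>D\<^sub>t\<close>, all equations but \<open>f\<^sub>0 = 1\<close>
  (which is \<open>N\<^sub>1 = D\<close>) become identities between neighbouring members of the
  three polynomial sequences (\<open>N3_eq\<close>, \<open>N3_Suc\<close>, \<open>N2_Suc\<close>). Both sides of each identity satisfy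
  the same second order recurrence, so two initial values decide it.
\<close>

section \<open>The linear system\<close>

definition luk_system ::
  "nat \<Rightarrow> (nat \<Rightarrow> 'a::comm_ring_1 fps) \<Rightarrow> (nat \<Rightarrow> 'a fps) \<Rightarrow> (nat \<Rightarrow> 'a fps) \<Rightarrow> bool" where
  "luk_system t F G H \<longleftrightarrow>
     F 0 = 1 \<and>
     (\<forall>k<t. F (Suc k) = fps_X * (F k + G k + H k)) \<and>
     (\<forall>k\<le>t. G k = fps_X * (\<Sum>j\<in>{k<..t}. F j + G j + H j)) \<and>
     (\<forall>k\<le>t. H k = fps_X * (F k + G k + H k))"

text \<open>Induction on the coefficient index, simultaneously for all heights: the factor \<open>fps_X\<close> makes
  each coefficient of an unknown depend only on coefficients of the preceding index.\<close>

lemma luk_system_unique: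
  assumes "luk_system t F G H" "luk_system t F' G' H'" "k \<le> t"
  shows "F k = F' k \<and> G k = G' k \<and> H k = H' k"
proof -
  have "\<forall>k\<le>t. F k $ n = F' k $ n \<and> G k $ n = G' k $ n \<and> H k $ n = H' k $ n" for n
  proof (induction n)
    case 0
    show ?case
    proof (intro allI impI)
      fix k assume k: "k \<le> t"
      have "F k $ 0 = F' k $ 0"
        using assms(1,2) k by (cases k) (simp_all add: luk_system_def)
      moreover have "fps_nth (G k) 0 = 0" "fps_nth (G' k) 0 = 0"
          "fps_nth (H k) 0 = 0" "fps_nth (H' k) 0 = 0"
        using assms(1,2) k unfolding luk_system_def
        by (metis fps_mult_nth_0 fps_X_nth mult_zero_left zero_neq_one)+
      ultimately show "F k $ 0 = F' k $ 0 \<and> G k $ 0 = G' k $ 0 \<and> H k $ 0 = H' k $ 0"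
        by simp
    qed
  next
    case (Suc n)
    define W where "W j = F j + G j + H j" for j
    define W' where "W' j = F' j + G' j + H' j" for j
    have W: "W j $ n = W' j $ n" if "j \<le> t" for j
      using Suc.IH that by (simp add: W_def W'_def)
    show ?case
    proof (intro allI impI)
      fix k assume k: "k \<le> t"
      have "F k $ Suc n = F' k $ Suc n"
      proof (cases k)
        case 0
        then show ?thesis using assms(1,2) by (simp add: luk_system_def)
      next
        case (Suc i)
        then have "F k = fps_X * W i" "F' k = fps_X * W' i"
          using assms(1,2) k by (auto simp: luk_system_def W_def W'_def)
        then show ?thesis using W[of i] Suc k by simp
      qed
      moreover have "H k $ Suc n = H' k $ Suc n"
      proof -
        have "H k = fps_X * W k" "H' k = fps_X * W' k"
          using assms(1,2) k by (auto simp: luk_system_def W_def W'_def)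
        then show ?thesis using W[of k] k by simp
      qed
      moreover have "G k $ Suc n = G' k $ Suc n"
      proof -
        have "G k = fps_X * (\<Sum>j\<in>{k<..t}. W j)" "G' k = fps_X * (\<Sum>j\<in>{k<..t}. W' j)"
          using assms(1,2) k by (auto simp: luk_system_def W_def W'_def)
        then show ?thesis using W by (simp add: fps_sum_nth)
      qed
      ultimately show "F k $ Suc n = F' k $ Suc n \<and> G k $ Suc n = G' k $ Suc n \<and>
          H k $ Suc n = H' k $ Suc n" by simp
    qed
  qed
  then show ?thesis using assms(3) by (simp add: fps_eq_iff)
qed

section \<open>Removing the last step\<close>

lemma luk_paths_iff:
  "s \<in> luk_paths t k n \<longleftrightarrow> length s = n \<and> (\<forall>j\<in>set s. j \<le> 1) \<and>
     (\<forall>i\<le>n. 0 \<le> ycoord s i \<and> ycoord s i \<le> int t) \<and> ycoord s n = int k"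
  unfolding luk_paths_def partial_luk_path_def path_height_def
  by (auto simp: Max_le_iff)

lemma luk_paths_0: "luk_paths t k 0 = (if k = 0 then {[]} else {})"
  by (auto simp: luk_paths_iff ycoord_def)

text \<open>The new point is the only one that the appended step contributes to the constraints, and its
  height is the prescribed end height \<open>k\<close>. Down-steps may be
  arbitrarily long, so any earlier height \<open>j \<le> t\<close> with \<open>k \<le> j + 1\<close> will do.\<close>

lemma snoc_in_luk_paths_iff:
  "s @ [d] \<in> luk_paths t k (Suc n) \<longleftrightarrow>
     k \<le> t \<and> d \<le> 1 \<and> (\<exists>j\<le>t. s \<in> luk_paths t j n \<and> d = int k - int j)"
proof -
  have y: "ycoord (s @ [d]) i = ycoord s i" if "i \<le> length s" for i
    using that by (simp add: ycoord_def)
  have yS: "ycoord (s @ [d]) (Suc (length s)) = ycoord s (length s) + d"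
    by (simp add: ycoord_def)
  have split: "(\<forall>i\<le>Suc n. P i) \<longleftrightarrow> (\<forall>i\<le>n. P i) \<and> P (Suc n)" for P
    by (auto simp: le_Suc_eq)
  show ?thesis
  proof
    assume "s @ [d] \<in> luk_paths t k (Suc n)"
    then have a: "length s = n" "d \<le> 1" "\<forall>j\<in>set s. j \<le> 1"
        "\<forall>i\<le>n. 0 \<le> ycoord s i \<and> ycoord s i \<le> int t"
        "ycoord s n + d = int k" "int k \<le> int t"
      using y yS by (auto simp: luk_paths_iff split)
    then have "s \<in> luk_paths t (nat (ycoord s n)) n" "nat (ycoord s n) \<le> t"
        "d = int k - int (nat (ycoord s n))"
      by (auto simp: luk_paths_iff nat_le_iff)
    then show "k \<le> t \<and> d \<le> 1 \<and> (\<exists>j\<le>t. s \<in> luk_paths t j n \<and> d = int k - int j)"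
      using a by auto
  next
    assume "k \<le> t \<and> d \<le> 1 \<and> (\<exists>j\<le>t. s \<in> luk_paths t j n \<and> d = int k - int j)"
    then show "s @ [d] \<in> luk_paths t k (Suc n)"
      using y yS by (auto simp: luk_paths_iff split)
  qed
qed

definition path_gf :: "nat \<Rightarrow> nat \<Rightarrow> rat fps" where
  "path_gf t k = Abs_fps (\<lambda>n. of_nat (card (luk_paths t k n)))"

definition last_step_gf :: "(int \<Rightarrow> bool) \<Rightarrow> nat \<Rightarrow> nat \<Rightarrow> rat fps" where
  "last_step_gf P t k =
     Abs_fps (\<lambda>n. of_nat (card {s \<in> luk_paths t k n. s \<noteq> [] \<and> P (last s)}))"

text \<open>Since the end point is known, prescribing the last step amounts to prescribing the height
  from which it starts.\<close>

lemma last_step_gf_eq: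
  assumes "k \<le> t"
  shows "last_step_gf P t k =
    fps_X * (\<Sum>j | j \<le> t \<and> k \<le> Suc j \<and> P (int k - int j). path_gf t j)"
proof (rule fps_ext)
  fix n
  let ?J = "{j. j \<le> t \<and> k \<le> Suc j \<and> P (int k - int j)}"
  show "last_step_gf P t k $ n = (fps_X * (\<Sum>j\<in>?J. path_gf t j)) $ n"
  proof (cases n)
    case 0
    have "{s \<in> luk_paths t k 0. s \<noteq> [] \<and> P (last s)} = {}"
      by (auto simp: luk_paths_0)
    then have "card {s \<in> luk_paths t k 0. s \<noteq> [] \<and> P (last s)} = 0" by (simp only: card.empty)
    then show ?thesis using 0 by (simp add: last_step_gf_def)
  next
    case (Suc m)
    let ?A = "\<lambda>j. (\<lambda>s. s @ [int k - int j]) ` luk_paths t j m"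
    have "{s \<in> luk_paths t k (Suc m). s \<noteq> [] \<and> P (last s)} = (\<Union>j\<in>?J. ?A j)" (is "?L = ?R")
    proof (rule set_eqI)
      fix s
      show "s \<in> ?L \<longleftrightarrow> s \<in> ?R"
      proof (cases s rule: rev_cases)
        case Nil
        then show ?thesis by auto
      next
        case (snoc r d)
        then show ?thesis using assms by (auto simp: snoc_in_luk_paths_iff)
      qed
    qed
    moreover have "card (\<Union>j\<in>?J. ?A j) = (\<Sum>j\<in>?J. card (?A j))"
      by (intro card_UN_disjoint) (auto simp: finite_luk_paths)
    moreover have "card (?A j) = card (luk_paths t j m)" for j
      by (intro card_image) (simp add: inj_on_def)
    ultimately have "card ?L = (\<Sum>j\<in>?J. card (luk_paths t j m))"
      by simp
    then show ?thesis using Suc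
      by (simp add: last_step_gf_def path_gf_def fps_sum_nth)
  qed
qed

lemma gf_eq_last_step_gf:
  shows "f_gf t k = (if k = 0 then 1 else 0) + last_step_gf (\<lambda>d. d = 1) t k"
    and "g_gf t k = last_step_gf (\<lambda>d. d \<le> -1) t k"
    and "h_gf t k = last_step_gf (\<lambda>d. d = 0) t k"
proof -
  show "f_gf t k = (if k = 0 then 1 else 0) + last_step_gf (\<lambda>d. d = 1) t k"
  proof (rule fps_ext)
    fix n
    show "f_gf t k $ n = ((if k = 0 then 1 else 0) + last_step_gf (\<lambda>d. d = 1) t k) $ n"
    proof (cases n)
      case 0
      have "{s \<in> luk_paths t k 0. s = [] \<or> last s = 1} = (if k = 0 then {[]} else {})"
        "{s \<in> luk_paths t k 0. s \<noteq> [] \<and> last s = 1} = {}"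
        by (auto simp: luk_paths_0)
      then show ?thesis using 0 by (simp add: f_gf_def last_step_gf_def del: Collect_empty_eq)
    next
      case (Suc m)
      have "{s \<in> luk_paths t k n. s = [] \<or> last s = 1} =
          {s \<in> luk_paths t k n. s \<noteq> [] \<and> last s = 1}"
        using Suc by (auto simp: luk_paths_iff)
      then show ?thesis using Suc by (simp add: f_gf_def last_step_gf_def)
    qed
  qed
qed (simp_all add: g_gf_def h_gf_def last_step_gf_def)

text \<open>The three kinds of last step are exhaustive because no step exceeds \<open>1\<close>; the empty path is
  counted on the right by \<open>f_gf\<close>.\<close>

lemma path_gf_eq: "path_gf t k = f_gf t k + g_gf t k + h_gf t k"
proof (rule fps_ext)
  fix n
  let ?L = "luk_paths t k n"
  let ?F = "{s \<in> ?L. s = [] \<or> last s = 1}"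
  let ?G = "{s \<in> ?L. s \<noteq> [] \<and> last s \<le> -1}"
  let ?H = "{s \<in> ?L. s \<noteq> [] \<and> last s = 0}"
  have "last s \<le> 1" if "s \<in> ?L" "s \<noteq> []" for s
    using that last_in_set[of s] by (auto simp: luk_paths_iff)
  then have "?L = (?F \<union> ?G) \<union> ?H"
    by fastforce
  moreover have "card ((?F \<union> ?G) \<union> ?H) = card (?F \<union> ?G) + card ?H"
    by (intro card_Un_disjoint) (auto simp: finite_luk_paths)
  moreover have "card (?F \<union> ?G) = card ?F + card ?G"
    by (intro card_Un_disjoint) (auto simp: finite_luk_paths)
  ultimately have "card ?L = card ?F + card ?G + card ?H" by metis
  then show "path_gf t k $ n = (f_gf t k + g_gf t k + h_gf t k) $ n"
    by (simp add: path_gf_def f_gf_def g_gf_def h_gf_def)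
qed

lemma luk_system_gf: "luk_system t (f_gf t) (g_gf t) (h_gf t)"
proof -
  have "f_gf t 0 = 1"
    by (simp add: gf_eq_last_step_gf last_step_gf_eq)
  moreover have "f_gf t (Suc k) = fps_X * path_gf t k" if "k < t" for k
  proof -
    have "{j. j \<le> t \<and> Suc k \<le> Suc j \<and> int (Suc k) - int j = 1} = {k}"
      using that by auto
    then show ?thesis using that by (simp add: gf_eq_last_step_gf last_step_gf_eq)
  qed
  moreover have "g_gf t k = fps_X * (\<Sum>j\<in>{k<..t}. path_gf t j)" if "k \<le> t" for k
  proof -
    have "{j. j \<le> t \<and> k \<le> Suc j \<and> int k - int j \<le> -1} = {k<..t}"
      by auto
    then show ?thesis using that by (simp add: gf_eq_last_step_gf last_step_gf_eq)
  qed
  moreover have "h_gf t k = fps_X * path_gf t k" if "k \<le> t" for k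
  proof -
    have "{j. j \<le> t \<and> k \<le> Suc j \<and> int k - int j = 0} = {k}"
      using that by auto
    then show ?thesis using that by (simp add: gf_eq_last_step_gf last_step_gf_eq)
  qed
  ultimately show ?thesis
    unfolding luk_system_def path_gf_eq[symmetric] by blast
qed

section \<open>The quotients solve the system\<close>

lemma recurrence_eqI:
  fixes a b :: "nat \<Rightarrow> 'a::ring_1"
  assumes "a 0 = b 0" "a (Suc 0) = b (Suc 0)"
    and "\<And>m. a (Suc (Suc m)) = - a (Suc m) - z * a m"
    and "\<And>m. b (Suc (Suc m)) = - b (Suc m) - z * b m"
  shows "a m = b m"
  by (induction m rule: D.induct) (simp_all add: assms)

text \<open>The next three identities are what the equations of the system become for the quotients:
  \<open>N3_eq\<close> is the one for horizontal steps; \<open>N3_Suc\<close> says that \<open>z w\<^bsub>k-1\<^esub>\<close>, which is \<open>h\<^bsub>k-1\<^esub>\<close>, agrees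
  with \<open>f\<^sub>k\<close>; \<open>N2_Suc\<close> is the telescoped equation \<open>g\<^sub>k = g\<^bsub>k+1\<^esub> + h\<^bsub>k+1\<^esub>\<close> for down-steps. Passing from
  \<open>k\<close> to \<open>k + 1\<close> lowers the index \<open>t - k\<close> by one and contributes the factor \<open>-z\<close>.\<close>

lemma N3_Suc: "N3 (Suc m) = - (Z * D m)"
proof (rule recurrence_eqI[where z = Z])
  show "N3 (Suc (Suc (Suc m))) = - N3 (Suc (Suc m)) - Z * N3 (Suc m)" for m
    by (simp only: D.simps N2.simps N3.simps)
  show "- (Z * D (Suc (Suc m))) = - (- (Z * D (Suc m))) - Z * (- (Z * D m))" for m
    by (simp only: D.simps N2.simps N3.simps) algebra
qed (simp_all add: numeral_poly one_pCons power2_eq_square)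

lemma N2_Suc: "N2 (Suc m) = - (Z * (N2 m + N3 m))"
proof (rule recurrence_eqI[where z = Z])
  show "N2 (Suc (Suc (Suc m))) = - N2 (Suc (Suc m)) - Z * N2 (Suc m)" for m
    by (simp only: D.simps N2.simps N3.simps)
  show "- (Z * (N2 (Suc (Suc m)) + N3 (Suc (Suc m)))) =
      - (- (Z * (N2 (Suc m) + N3 (Suc m)))) - Z * (- (Z * (N2 m + N3 m)))" for m
    by (simp only: D.simps N2.simps N3.simps) algebra
qed (simp_all add: numeral_poly one_pCons power2_eq_square)

lemma N3_eq: "N3 m = Z * (D m + N2 m + N3 m)"
proof (rule recurrence_eqI[where z = Z])
  show "N3 (Suc (Suc m)) = - N3 (Suc m) - Z * N3 m" for m
    by (simp only: D.simps N2.simps N3.simps)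
  show "Z * (D (Suc (Suc m)) + N2 (Suc (Suc m)) + N3 (Suc (Suc m))) =
      - (Z * (D (Suc m) + N2 (Suc m) + N3 (Suc m))) - Z * (Z * (D m + N2 m + N3 m))" for m
    by (simp only: D.simps N2.simps N3.simps) algebra
qed (simp_all add: numeral_poly one_pCons power2_eq_square)

lemma rat_fps_nth: "rat_fps p $ n = of_int (coeff p n)"
  by (simp add: rat_fps_def coeff_map_poly)

lemma rat_fps_add: "rat_fps (p + q) = rat_fps p + rat_fps q"
  by (rule fps_ext) (simp add: rat_fps_nth)

lemma rat_fps_uminus: "rat_fps (- p) = - rat_fps p"
  by (rule fps_ext) (simp add: rat_fps_nth)

lemma rat_fps_Z_mult: "rat_fps (Z * p) = fps_X * rat_fps p"
  by (rule fps_ext) (simp add: rat_fps_nth coeff_pCons split: nat.split)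

lemma luk_system_quotients:
  fixes t :: nat
  defines "q \<equiv> \<lambda>N k. (-1) ^ k * fps_X ^ k * (rat_fps (N (t - k)) / rat_fps (D t))"
  shows "luk_system t (q N1) (q N2) (q N3)"
proof -
  define u where "u = inverse (rat_fps (D t))"
  \<comment> \<open>Division by a power series with nonzero constant term is multiplication by \<open>u\<close>, so that \<open>u\<close>
    becomes a common factor of all equations.\<close>
  have unit: "rat_fps (D t) $ 0 \<noteq> 0"
    by (simp add: rat_fps_D_nth_0)
  have q: "q N k = (- fps_X) ^ k * rat_fps (N (t - k)) * u" for N k
    unfolding q_def u_def fps_divide_unit[OF unit] power_minus[of fps_X k]
    by (simp add: mult.assoc)
  define w where "w k = q N1 k + q N2 k + q N3 k" for k
  have w: "w k = (- fps_X) ^ k * rat_fps (D (t - k) + N2 (t - k) + N3 (t - k)) * u" for k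
    by (simp add: w_def q N1_def rat_fps_add algebra_simps)
  have H: "q N3 k = fps_X * w k" for k
    unfolding w q by (subst N3_eq) (simp only: rat_fps_Z_mult mult_ac)
  have F0: "q N1 0 = 1"
    using inverse_mult_eq_1[OF unit] by (simp add: q N1_def u_def mult.commute)
  have diff: "t - k = Suc (t - Suc k)" if "k < t" for k
    using that by simp
  have FS: "q N1 (Suc k) = fps_X * w k" if "k < t" for k
    unfolding H[symmetric] q diff[OF that] N3_Suc N1_def
    by (simp only: rat_fps_uminus rat_fps_Z_mult) simp
  have G_step: "q N2 k = q N2 (Suc k) + q N3 (Suc k)" if "k < t" for k
    unfolding q diff[OF that] N2_Suc
    by (simp only: rat_fps_uminus rat_fps_Z_mult rat_fps_add) (simp add: algebra_simps)
  have G: "q N2 k = fps_X * (\<Sum>j\<in>{k<..t}. w j)" if "k \<le> t" for k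
    using that
  proof (induction rule: inc_induct)
    case base
    \<comment> \<open>Nothing lies above height \<open>t\<close>, and \<open>N2 0 = 0\<close>.\<close>
    show ?case by (simp add: q rat_fps_def)
  next
    case (step k)
    have "{k<..t} = insert (Suc k) {Suc k<..t}"
      using step by auto
    then show ?case
      using step G_step[of k] H[of "Suc k"] by (simp add: algebra_simps)
  qed
  show ?thesis
    using F0 FS G H unfolding luk_system_def w_def by blast
qed

theorem theorem5:
  fixes k t :: nat
  assumes "k \<le> t"
  shows "f_gf t k = (-1) ^ k * fps_X ^ k * (rat_fps (N1 (t - k)) / rat_fps (D t)) \<and>
         g_gf t k = (-1) ^ k * fps_X ^ k * (rat_fps (N2 (t - k)) / rat_fps (D t)) \<and>
         h_gf t k = (-1) ^ k * fps_X ^ k * (rat_fps (N3 (t - k)) / rat_fps (D t))"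
  using luk_system_unique[OF luk_system_gf luk_system_quotients assms] .

end
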